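(* For any finite set $\mathcal{M}$, any two-dimensional Hilbert space $\mathcal{H}$, and any ensemble $\boldsymbol{\rho} \in \mathcal{E}(\mathcal{M},\mathcal{H})$ such that the prior probability distribution is uniform, i.e. $\operatorname{Tr}[\boldsymbol{\rho}(m)] = |\mathcal{M}|^{-1}$ for every $m \in \mathcal{M}$, there exists a numbering $\mathbf{n}^* \in \mathcal{N}_{\mathcal{M}}$ such that the measurement $\boldsymbol{\pi}_{\boldsymbol{\rho},\mathbf{n}^*}$ minimizes the guesswork, that is, $$G_{\min}(\boldsymbol{\rho}) = G(\boldsymbol{\rho}, \boldsymbol{\pi}_{\boldsymbol{\rho},\mathbf{n}^*}).$$
   Context: $\mathcal{L}(\mathcal{H})$ is the space of Hermitian operators on $\mathcal{H}$, $\mathcal{L}_+(\mathcal{H})$ the cone of positive semidefinite operators on $\mathcal{H}$, $\mathbb{1}$ the identity. For Hermitian $A$, $\Pi_-(A)$ and $\Pi_0(A)$ are the projectors on the negative and null parts of $A$, i.e. onto the span of the eigenvectors of $A$ with negative eigenvalue and onto the kernel of $A$, respectively. For a finite set $\mathcal{M}$: - $\mathcal{N}_{\mathcal{M}}$ is the set of numberings, i.e. bijections $\mathbf{n}:\{1,\dots,|\mathcal{M}|\}\to\mathcal{M}$. The reversed numbering is $\overline{\mathbf{n}}(t) := \mathbf{n}(|\mathcal{M}|+1-t)$. - $\mathcal{E}(\mathcal{M},\mathcal{H})$ is the set of ensembles, i.e. maps $\boldsymbol{\rho}:\mathcal{M}\to\mathcal{L}_+(\mathcal{H})$ with $\sum_{m\in\mathcal{M}}\operatorname{Tr}[\boldsymbol{\rho}(m)]=1$.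 - $\mathcal{P}(\mathcal{N}_{\mathcal{M}},\mathcal{H})$ is the set of numbering-valued measurements, i.e. maps $\boldsymbol{\pi}:\mathcal{N}_{\mathcal{M}}\to\mathcal{L}_+(\mathcal{H})$ with $\sum_{\mathbf{n}\in\mathcal{N}_{\mathcal{M}}}\boldsymbol{\pi}(\mathbf{n})=\mathbb{1}$. The guesswork is $G(\boldsymbol{\rho},\boldsymbol{\pi}) := \sum_{t=1}^{|\mathcal{M}|} t\, q_{\boldsymbol{\rho},\boldsymbol{\pi}}(t)$, where $q_{\boldsymbol{\rho},\boldsymbol{\pi}}(t) := \sum_{\mathbf{n}\in\mathcal{N}_{\mathcal{M}}}\operatorname{Tr}[\boldsymbol{\rho}(\mathbf{n}(t))\,\boldsymbol{\pi}(\mathbf{n})]$. The minimum guesswork is $G_{\min}(\boldsymbol{\rho}) := \min_{\boldsymbol{\pi}\in\mathcal{P}(\mathcal{N}_{\mathcal{M}},\mathcal{H})} G(\boldsymbol{\rho},\boldsymbol{\pi})$. The map $E_{\boldsymbol{\rho}}:\mathcal{N}_{\mathcal{M}}\to\mathcal{L}(\mathcal{H})$ is $E_{\boldsymbol{\rho}}(\mathbf{n}) := \sum_{t=1}^{|\mathcal{M}|}(2t-|\mathcal{M}|-1)\,\boldsymbol{\rho}(\mathbf{n}(t))$. For $\mathbf{n}^*\in\mathcal{N}_{\mathcal{M}}$, the numbering-valued measurement $\boldsymbol{\pi}_{\boldsymbol{\rho},\mathbf{n}^*}$ is given by $\boldsymbol{\pi}_{\boldsymbol{\rho},\mathbf{n}^*}(\mathbf{n})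 := \Pi_-(E_{\boldsymbol{\rho}}(\mathbf{n})) + \tfrac12 \Pi_0(E_{\boldsymbol{\rho}}(\mathbf{n}))$ if $\mathbf{n}\in\{\mathbf{n}^*,\overline{\mathbf{n}^*}\}$, and $0$ otherwise.
   Formalization: The case |M| = 1 is excluded: there the only numbering equals its reversal, E is zero and the prescribed map takes the single value half the identity, which is not a measurement and has guesswork 1/2, while the minimum guesswork is 1. *)

theory Defs
  imports Complex_Main "HOL-Library.FuncSet" "HOL-Library.Product_Plus"
begin

text \<open>
  A complex inner product space; the inner product is conjugate linear in the first argument.
  In finite dimension completeness is automatic, so the types of this class with
  \<open>cdim UNIV = 2\<close> are exactly the two-dimensional complex Hilbert spaces.
\<close>

class complex_inner = ab_group_add +
  fixes scaleC :: "complex \<Rightarrow> 'a \<Rightarrow> 'a"  (infixr \<open>*\<^sub>C\<close> 75)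
    and cinner :: "'a \<Rightarrow> 'a \<Rightarrow> complex"
  assumes scaleC_add_right: "a *\<^sub>C (x + y) = a *\<^sub>C x + a *\<^sub>C y"
    and scaleC_add_left: "(a + b) *\<^sub>C x = a *\<^sub>C x + b *\<^sub>C x"
    and scaleC_scaleC: "a *\<^sub>C (b *\<^sub>C x) = (a * b) *\<^sub>C x"
    and scaleC_one: "1 *\<^sub>C x = x"
    and cinner_commute: "cinner x y = cnj (cinner y x)"
    and cinner_add_right: "cinner x (y + z) = cinner x y + cinner x z"
    and cinner_scaleC_right: "cinner x (a *\<^sub>C y) = a * cinner x y"
    and cinner_ge_zero: "0 \<le> Re (cinner x x)"
    and cinner_eq_zero_iff: "cinner x x = 0 \<longleftrightarrow> x = 0"

global_interpretation complex_vector: vector_space "scaleC :: complex \<Rightarrow> 'h \<Rightarrow> 'h::complex_inner"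
  defines cspan = "module.span (scaleC :: complex \<Rightarrow> 'h \<Rightarrow> 'h::complex_inner)"
    and cdim = "vector_space.dim (scaleC :: complex \<Rightarrow> 'h \<Rightarrow> 'h::complex_inner)"
  by unfold_locales
    (simp_all add: scaleC_add_right scaleC_add_left scaleC_scaleC scaleC_one)

text \<open>The instances show that the class is inhabited, in particular in dimension two.\<close>

instantiation complex :: complex_inner
begin
definition "scaleC_complex (a :: complex) (x :: complex) = a * x"
definition "cinner_complex (x :: complex) (y :: complex) = cnj x * y"
instance
  by standard (auto simp: scaleC_complex_def cinner_complex_def algebra_simps)
end

lemma cinner_self_real: "cinner x x = complex_of_real (Re (cinner x x))"
  using cinner_commute[of x x] by (simp add: complex_eq_iff)

instantiation prod :: (complex_inner, complex_inner) complex_inner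
begin
definition "scaleC_prod a (x :: 'a \<times> 'b) = (a *\<^sub>C fst x, a *\<^sub>C snd x)"
definition "cinner_prod (x :: 'a \<times> 'b) (y :: 'a \<times> 'b) = cinner (fst x) (fst y) + cinner (snd x) (snd y)"
instance
proof
  fix x :: "'a \<times> 'b"
  have "Re (cinner (fst x) (fst x)) + Re (cinner (snd x) (snd x)) = 0 \<longleftrightarrow>
      Re (cinner (fst x) (fst x)) = 0 \<and> Re (cinner (snd x) (snd x)) = 0"
    by (rule add_nonneg_eq_0_iff) (rule cinner_ge_zero)+
  then have "cinner x x = 0 \<longleftrightarrow> cinner (fst x) (fst x) = 0 \<and> cinner (snd x) (snd x) = 0"
    unfolding cinner_prod_def
    by (metis add.right_neutral cinner_self_real of_real_0 plus_complex.simps(1) zero_complex.simps(1))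
  then show "cinner x x = 0 \<longleftrightarrow> x = 0"
    by (simp add: cinner_eq_zero_iff prod_eq_iff)
next
  fix x y :: "'a \<times> 'b"
  show "cinner x y = cnj (cinner y x)"
    unfolding cinner_prod_def
    by (metis cinner_commute complex_cnj_add)
qed (auto simp: scaleC_prod_def cinner_prod_def scaleC_add_right scaleC_add_left scaleC_scaleC
    scaleC_one cinner_add_right cinner_scaleC_right cinner_ge_zero algebra_simps)
end


subsection \<open>Operators\<close>

abbreviation clinear :: "('h::complex_inner \<Rightarrow> 'h) \<Rightarrow> bool" where
  "clinear \<equiv> Vector_Spaces.linear scaleC scaleC"

definition hermitian :: "('h::complex_inner \<Rightarrow> 'h) \<Rightarrow> bool" where
  "hermitian A \<longleftrightarrow> clinear A \<and> (\<forall>x y. cinner x (A y) = cinner (A x) y)"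

definition pos_semidef :: "('h::complex_inner \<Rightarrow> 'h) \<Rightarrow> bool" where
  "pos_semidef A \<longleftrightarrow> hermitian A \<and> (\<forall>x. 0 \<le> Re (cinner x (A x)))"

definition orthonormal_basis :: "'h::complex_inner set \<Rightarrow> bool" where
  "orthonormal_basis B \<longleftrightarrow> finite B \<and>
     (\<forall>b\<in>B. \<forall>c\<in>B. cinner b c = (if b = c then 1 else 0)) \<and> cspan B = UNIV"

text \<open>
  The trace of an operator on a finite-dimensional space. For linear operators it does not depend
  on the chosen orthonormal basis, see \<open>trace_eq_sum\<close> below.
\<close>

definition trace :: "('h::complex_inner \<Rightarrow> 'h) \<Rightarrow> complex" where
  "trace A = (\<Sum>b\<in>(SOME B. orthonormal_basis B). cinner b (A b))"

definition orth_proj :: "'h::complex_inner set \<Rightarrow> 'h \<Rightarrow> 'h" where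
  "orth_proj S x = (THE y. y \<in> S \<and> (\<forall>z\<in>S. cinner z (x - y) = 0))"

definition proj_neg :: "('h::complex_inner \<Rightarrow> 'h) \<Rightarrow> 'h \<Rightarrow> 'h" where
  "proj_neg A = orth_proj (cspan {x. x \<noteq> 0 \<and> (\<exists>l::real. l < 0 \<and> A x = complex_of_real l *\<^sub>C x)})"

definition proj_null :: "('h::complex_inner \<Rightarrow> 'h) \<Rightarrow> 'h \<Rightarrow> 'h" where
  "proj_null A = orth_proj {x. A x = 0}"

lemma cinner_sum_right:
  "cinner x (\<Sum>i\<in>I. f i) = (\<Sum>i\<in>I. cinner x (f i))" for x :: "'h::complex_inner"
proof (induction I rule: infinite_finite_induct)
  case (insert i I)
  then show ?case by (simp add: cinner_add_right)
qed (use cinner_scaleC_right[of x 0 0] in \<open>simp_all add: complex_vector.scale_zero_left\<close>)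

lemma orthonormal_expansion:
  assumes "orthonormal_basis B"
  shows "x = (\<Sum>b\<in>B. cinner b x *\<^sub>C b)"
proof -
  have B: "finite B" and on: "\<And>b c. b \<in> B \<Longrightarrow> c \<in> B \<Longrightarrow> cinner b c = (if b = c then 1 else 0)"
    and "cspan B = UNIV"
    using assms by (auto simp: orthonormal_basis_def)
  then have "x \<in> range (\<lambda>u. \<Sum>v\<in>B. u v *\<^sub>C v)"
    using complex_vector.span_finite[OF B] by (simp add: cspan_def)
  then obtain u where u: "x = (\<Sum>v\<in>B. u v *\<^sub>C v)"
    by blast
  have "cinner b x = u b" if "b \<in> B" for b
  proof -
    have "cinner b x = (\<Sum>v\<in>B. u v * (if b = v then 1 else 0))"
      unfolding u cinner_sum_right cinner_scaleC_right using that on by (intro sum.cong) auto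
    then show ?thesis using B that by (simp add: if_distrib cong: if_cong)
  qed
  then show ?thesis by (subst u) (simp cong: sum.cong)
qed

lemma trace_eq_sum:
  assumes "clinear A" and B: "orthonormal_basis B"
  shows "trace A = (\<Sum>b\<in>B. cinner b (A b))"
proof -
  interpret A: Vector_Spaces.linear scaleC scaleC A by (rule assms)
  define C :: "'a set" where "C = (SOME C. orthonormal_basis C)"
  have C: "orthonormal_basis C" unfolding C_def using B by (rule someI)
  have "(\<Sum>c\<in>C. cinner c (A c)) = (\<Sum>c\<in>C. cinner c (\<Sum>b\<in>B. cinner b c *\<^sub>C A b))"
    by (subst orthonormal_expansion[OF B]) (simp add: A.sum A.scale)
  also have "\<dots> = (\<Sum>b\<in>B. cinner b (\<Sum>c\<in>C. cinner c (A b) *\<^sub>C c))"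
    unfolding cinner_sum_right cinner_scaleC_right by (subst sum.swap) (simp add: mult.commute)
  also have "\<dots> = (\<Sum>b\<in>B. cinner b (A b))"
    using orthonormal_expansion[OF C] by simp
  finally show ?thesis by (simp add: trace_def C_def)
qed


subsection \<open>Guesswork\<close>

text \<open>
  Numberings are taken extensional, i.e. \<open>undefined\<close> outside \<open>{1..card M}\<close>, so that each
  bijection is counted exactly once.
\<close>

definition numberings :: "'m set \<Rightarrow> (nat \<Rightarrow> 'm) set" where
  "numberings M = {n \<in> extensional {1..card M}. bij_betw n {1..card M} M}"

definition reversed :: "'m set \<Rightarrow> (nat \<Rightarrow> 'm) \<Rightarrow> nat \<Rightarrow> 'm" where
  "reversed M n = restrict (\<lambda>t. n (card M + 1 - t)) {1..card M}"

definition ensembles :: "'m set \<Rightarrow> ('m \<Rightarrow> 'h::complex_inner \<Rightarrow> 'h) set" where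
  "ensembles M = {\<rho>. (\<forall>m\<in>M. pos_semidef (\<rho> m)) \<and> (\<Sum>m\<in>M. trace (\<rho> m)) = 1}"

definition measurements :: "'m set \<Rightarrow> ((nat \<Rightarrow> 'm) \<Rightarrow> 'h::complex_inner \<Rightarrow> 'h) set" where
  "measurements M = {\<pi>. (\<forall>n\<in>numberings M. pos_semidef (\<pi> n)) \<and>
     (\<forall>x. (\<Sum>n\<in>numberings M. \<pi> n x) = x)}"

text \<open>
  The traces below are real for ensembles and measurements, being traces of products of two
  Hermitian operators; the real part only turns them into elements of type \<open>real\<close>.
\<close>

definition guess_prob ::
    "'m set \<Rightarrow> ('m \<Rightarrow> 'h::complex_inner \<Rightarrow> 'h) \<Rightarrow> ((nat \<Rightarrow> 'm) \<Rightarrow> 'h \<Rightarrow> 'h) \<Rightarrow> nat \<Rightarrow> real" where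
  "guess_prob M \<rho> \<pi> t = (\<Sum>n\<in>numberings M. Re (trace (\<rho> (n t) \<circ> \<pi> n)))"

definition guesswork ::
    "'m set \<Rightarrow> ('m \<Rightarrow> 'h::complex_inner \<Rightarrow> 'h) \<Rightarrow> ((nat \<Rightarrow> 'm) \<Rightarrow> 'h \<Rightarrow> 'h) \<Rightarrow> real" where
  "guesswork M \<rho> \<pi> = (\<Sum>t=1..card M. real t * guess_prob M \<rho> \<pi> t)"

text \<open>The minimum exists in finite dimension, since the set of measurements is compact.\<close>

definition min_guesswork :: "'m set \<Rightarrow> ('m \<Rightarrow> 'h::complex_inner \<Rightarrow> 'h) \<Rightarrow> real" where
  "min_guesswork M \<rho> = (LEAST g. g \<in> guesswork M \<rho> ` measurements M)"

definition guess_op ::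
    "'m set \<Rightarrow> ('m \<Rightarrow> 'h::complex_inner \<Rightarrow> 'h) \<Rightarrow> (nat \<Rightarrow> 'm) \<Rightarrow> 'h \<Rightarrow> 'h" where
  "guess_op M \<rho> n =
     (\<lambda>x. \<Sum>t=1..card M. complex_of_real (2 * real t - real (card M) - 1) *\<^sub>C \<rho> (n t) x)"

text \<open>
  For \<open>card M = 1\<close> the numberings \<open>ns\<close> and \<open>reversed M ns\<close> coincide, and then this is not a
  measurement: its only value is half the identity.
\<close>

definition guess_meas ::
    "'m set \<Rightarrow> ('m \<Rightarrow> 'h::complex_inner \<Rightarrow> 'h) \<Rightarrow> (nat \<Rightarrow> 'm) \<Rightarrow> (nat \<Rightarrow> 'm) \<Rightarrow> 'h \<Rightarrow> 'h" where
  "guess_meas M \<rho> ns n =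
     (if n \<in> {ns, reversed M ns}
      then (\<lambda>x. proj_neg (guess_op M \<rho> n) x + (1/2) *\<^sub>C proj_null (guess_op M \<rho> n) x)
      else (\<lambda>x. 0))"

end

theory Submission
  imports Defs
begin

text \<open>
  Writing \<open>t = (|M| + 1) / 2 + (2 t - |M| - 1) / 2\<close> turns the guesswork of \<open>\<pi>\<close> into
  \<open>(|M| + 1) / 2\<close> plus half the sum of the traces of \<open>E(n) \<pi>(n)\<close>. With uniform prior every \<open>E(n)\<close> is
  traceless, so in dimension two its eigenvalues are \<open>\<plusminus> l(n)\<close>, and the trace of \<open>E(n) \<pi>(n)\<close> is at
  least \<open>- l(n)\<close> times the trace of \<open>\<pi>(n)\<close>. The sum is therefore at least \<open>-2 max l\<close>. As
  reversing a numbering negates \<open>E\<close>, a numbering maximizing \<open>l\<close> together with its reversal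
  attains this bound.
\<close>

section \<open>Linear maps and the inner product\<close>

lemma clinearI:
  fixes A :: "'h::complex_inner \<Rightarrow> 'h"
  assumes "\<And>x y. A (x + y) = A x + A y" and "\<And>c x. A (c *\<^sub>C x) = c *\<^sub>C A x"
  shows "clinear A"
  using assms complex_vector.vector_space_axioms
  by (simp add: Vector_Spaces.linear_iff)

lemma
  assumes "clinear A"
  shows clinear_add: "A (x + y) = A x + A y" and clinear_scaleC: "A (c *\<^sub>C x) = c *\<^sub>C A x"
  using assms by (auto simp: Vector_Spaces.linear_iff)

lemma clinear_diff: "clinear A \<Longrightarrow> A (x - y) = A x - A y"
  by (metis add_diff_cancel_right' clinear_add diff_add_cancel)

lemma clinear_sum:
  assumes "clinear A"
  shows "A (\<Sum>i\<in>I. f i) = (\<Sum>i\<in>I. A (f i))"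
proof -
  interpret Vector_Spaces.linear scaleC scaleC A by (rule assms)
  show ?thesis by (rule sum)
qed

lemma cinner_zero_right [simp]: "cinner x (0::'h::complex_inner) = 0"
  using cinner_scaleC_right[of x 0 0] by simp

lemma cinner_zero_left [simp]: "cinner (0::'h::complex_inner) x = 0"
  using cinner_commute[of 0 x] by simp

lemma cinner_scaleC_left: "cinner (c *\<^sub>C x) z = cnj c * cinner x (z::'h::complex_inner)"
  by (metis cinner_commute cinner_scaleC_right complex_cnj_mult)

lemma cinner_diff_right: "cinner x (y - z) = cinner x y - cinner x (z::'h::complex_inner)"
  by (metis add_diff_cancel_right' cinner_add_right diff_add_cancel)

lemma cinner_sum_left: "cinner (\<Sum>i\<in>I. f i) x = (\<Sum>i\<in>I. cinner (f i) (x::'h::complex_inner))"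
  by (subst cinner_commute) (simp add: cinner_sum_right cinner_commute[symmetric])

text \<open>The factor is the inverse square root of \<open>cinner x x\<close>, which is real and,
  for a nonzero vector, positive.\<close>

lemma normalized_exists:
  fixes x :: "'h::complex_inner"
  assumes "x \<noteq> 0"
  obtains c where "cinner (c *\<^sub>C x) (c *\<^sub>C x) = 1"
proof -
  define r where "r = Re (cinner x x)"
  have r: "cinner x x = of_real r" unfolding r_def by (rule cinner_self_real)
  have "r \<noteq> 0" using assms cinner_eq_zero_iff[of x] r by auto
  moreover have "r \<ge> 0" unfolding r_def by (rule cinner_ge_zero)
  ultimately have "r > 0" by simp
  then have "inverse (sqrt r) * (inverse (sqrt r) * r) = 1"
    by (simp add: field_simps)
  then have "cinner (of_real (inverse (sqrt r)) *\<^sub>C x) (of_real (inverse (sqrt r)) *\<^sub>C x) = 1"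
    unfolding cinner_scaleC_left cinner_scaleC_right r complex_cnj_complex_of_real
      of_real_mult[symmetric] by simp
  then show thesis by (rule that)
qed


subsection \<open>Orthonormal bases in dimension two\<close>

text \<open>Orthogonality makes the pair independent. A vector outside its span would then give
  three independent vectors in a space spanned by two.\<close>

lemma orthonormal_pair_basis:
  fixes e f :: "'h::complex_inner"
  assumes dim: "cdim (UNIV :: 'h set) = 2"
    and ef: "cinner e e = 1" "cinner f f = 1" "cinner e f = 0"
  shows "e \<noteq> f" "orthonormal_basis {e, f}"
proof -
  show "e \<noteq> f" using ef by auto
  have fe: "cinner f e = 0" using ef(3) cinner_commute[of f e] by simp
  have indep: "complex_vector.independent {e, f}"
  proof -
    have "e \<notin> cspan {f}"
    proof
      assume "e \<in> cspan {f}"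
      then obtain k where "e = k *\<^sub>C f" by (auto simp: complex_vector.span_singleton)
      then have "cinner e e = k * cinner e f" using cinner_scaleC_right[of e k f] by simp
      then show False using ef by simp
    qed
    moreover have "f \<noteq> 0" using ef by auto
    ultimately show ?thesis
      using \<open>e \<noteq> f\<close> by (simp add: complex_vector.independent_insert)
  qed
  obtain B :: "'h set" where B: "complex_vector.independent B"
      "UNIV \<subseteq> cspan B" "card B = 2"
    using complex_vector.basis_exists[of UNIV] dim by metis
  have "finite B" using B(3) by (metis card.infinite zero_neq_numeral)
  have "x \<in> cspan {e, f}" for x
  proof (rule ccontr)
    assume x: "x \<notin> cspan {e, f}"
    then have "x \<notin> {e, f}" by (metis complex_vector.span_base)
    then have "complex_vector.independent (insert x {e, f})" "card (insert x {e, f}) = 3"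
      using x indep \<open>e \<noteq> f\<close> by (simp_all add: complex_vector.independent_insert[of x])
    then show False
      using complex_vector.independent_span_bound[OF \<open>finite B\<close>, of "insert x {e, f}"] B by auto
  qed
  then have "cspan {e, f} = UNIV"
    by auto
  then show "orthonormal_basis {e, f}"
    using ef fe \<open>e \<noteq> f\<close> by (auto simp: orthonormal_basis_def)
qed

text \<open>One Gram-Schmidt step: some \<open>v\<close> lies off the line of \<open>e\<close>,
  since otherwise the dimension would be at most one; its component along \<open>e\<close> is
  removed and the rest is normalized.\<close>

lemma extend_unit_vector:
  fixes e :: "'h::complex_inner"
  assumes dim: "cdim (UNIV :: 'h set) = 2" and e: "cinner e e = 1"
  obtains f where "e \<noteq> f" "orthonormal_basis {e, f}" "cinner f f = 1" "cinner e f = 0"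
proof -
  obtain v where v: "v - cinner e v *\<^sub>C e \<noteq> 0"
  proof (rule ccontr)
    assume "\<not> thesis"
    then have "v = cinner e v *\<^sub>C e" for v
      using that[of v] by auto
    then have "(UNIV :: 'h set) \<subseteq> cspan {e}"
      by (auto simp: complex_vector.span_singleton)
    then have "cdim (UNIV :: 'h set) \<le> card {e}"
      by (rule complex_vector.dim_le_card) simp
    then show False using dim by simp
  qed
  obtain c where c: "cinner (c *\<^sub>C (v - cinner e v *\<^sub>C e)) (c *\<^sub>C (v - cinner e v *\<^sub>C e)) = 1"
    using normalized_exists[OF v] by blast
  moreover have "cinner e (c *\<^sub>C (v - cinner e v *\<^sub>C e)) = 0"
    by (simp add: cinner_scaleC_right cinner_diff_right e)
  ultimately show thesis
    using orthonormal_pair_basis[OF dim e] that by blast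
qed

lemma orthonormal_pair_exists:
  assumes dim: "cdim (UNIV :: 'h::complex_inner set) = 2"
  obtains e f :: "'h::complex_inner" where "e \<noteq> f" "orthonormal_basis {e, f}"
    "cinner e e = 1" "cinner f f = 1" "cinner e f = 0"
proof -
  obtain x :: 'h where "x \<noteq> 0"
  proof (rule ccontr)
    assume "\<not> thesis"
    then have "(UNIV :: 'h set) \<subseteq> cspan {}"
      using that by auto
    then have "cdim (UNIV :: 'h set) \<le> card ({} :: 'h set)"
      by (rule complex_vector.dim_le_card) simp
    then show False using dim by simp
  qed
  then obtain c where c: "cinner (c *\<^sub>C x) (c *\<^sub>C x) = 1" by (rule normalized_exists)
  show thesis
    by (rule extend_unit_vector[OF dim c]) (rule that[OF _ _ c])
qed

text \<open>In an orthonormal basis the matrix of \<open>A\<close> has rows \<open>(a, z)\<close>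
  and \<open>(cnj z, - a)\<close> with \<open>a\<close> real, so its square is
  \<open>a\<^sup>2 + (cmod z)\<^sup>2\<close> times the identity. This gives the eigenvalues
  \<open>l\<close> and \<open>- l\<close> without a general spectral theorem.\<close>

lemma traceless_hermitian_eigenbasis:
  fixes A :: "'h::complex_inner \<Rightarrow> 'h"
  assumes dim: "cdim (UNIV :: 'h set) = 2" and A: "hermitian A" and tr: "trace A = 0"
  obtains b c and l :: real where "b \<noteq> c" "orthonormal_basis {b, c}" "l \<ge> 0"
    "A b = of_real l *\<^sub>C b" "A c = of_real (- l) *\<^sub>C c"
proof -
  have lin: "clinear A" and sym: "\<And>x y. cinner x (A y) = cinner (A x) y"
    using A by (auto simp: hermitian_def)
  obtain e f :: 'h where ef: "e \<noteq> f" "orthonormal_basis {e, f}"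
    "cinner e e = 1" "cinner f f = 1" "cinner e f = 0"
    using orthonormal_pair_exists[OF dim] .
  have expand: "x = cinner e x *\<^sub>C e + cinner f x *\<^sub>C f" for x
    using orthonormal_expansion[OF ef(2), of x] ef(1) by simp
  define a where "a = Re (cinner e (A e))"
  define z where "z = cinner e (A f)"
  define l where "l = sqrt (a\<^sup>2 + (cmod z)\<^sup>2)"
  have a: "cinner e (A e) = of_real a"
    using sym[of e e] cinner_commute[of e "A e"] by (simp add: a_def complex_eq_iff)
  have z': "cinner f (A e) = cnj z"
    unfolding z_def by (metis sym cinner_commute)
  have "cinner e (A e) + cinner f (A f) = 0"
    using trace_eq_sum[OF lin ef(2)] tr ef(1) by simp
  then have a': "cinner f (A f) = - of_real a"
    using a by (simp add: add_eq_0_iff)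
  have Ae: "A e = of_real a *\<^sub>C e + cnj z *\<^sub>C f"
    using expand[of "A e"] a z' by simp
  have Af: "A f = z *\<^sub>C e + (- of_real a) *\<^sub>C f"
    using expand[of "A f"] a' z_def by simp
  have l2: "complex_of_real a * of_real a + z * cnj z = of_real l * of_real l"
  proof -
    have "l * l = a * a + (cmod z)\<^sup>2"
      unfolding l_def by (simp add: power2_eq_square)
    then have "complex_of_real (l * l) = of_real (a * a) + (of_real (cmod z))\<^sup>2"
      by simp
    then show ?thesis by (simp flip: complex_norm_square of_real_power)
  qed
  have AAe: "A (A e) = (of_real l * of_real l) *\<^sub>C e"
  proof -
    have "A (A e) = (of_real a * of_real a + z * cnj z) *\<^sub>C e"
      by (subst Ae) (simp add: clinear_add[OF lin] clinear_scaleC[OF lin] Ae Af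
          complex_vector.scale_right_distrib complex_vector.scale_left_distrib algebra_simps)
    then show ?thesis by (simp add: l2)
  qed
  have AAf: "A (A f) = (of_real l * of_real l) *\<^sub>C f"
  proof -
    have "A (A f) = (of_real a * of_real a + z * cnj z) *\<^sub>C f"
      by (subst Af) (simp add: clinear_diff[OF lin] clinear_scaleC[OF lin] Ae Af
          complex_vector.scale_right_distrib complex_vector.scale_right_diff_distrib complex_vector.scale_left_distrib algebra_simps)
    then show ?thesis by (simp add: l2)
  qed
  have "l \<ge> 0" by (simp add: l_def)
  show thesis
  proof (cases "l = 0")
    case True
    \<comment> \<open>\<open>l\<close> is the root of a sum of two squares, so both vanish;
      \<open>A\<close> is then zero on \<open>e\<close> and \<open>f\<close>, which serve as
      eigenbasis themselves.\<close>
    then have "a = 0" "z = 0"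
      by (auto simp: l_def add_nonneg_eq_0_iff)
    then show thesis
      using that[OF ef(1,2), of 0] by (simp add: Ae Af)
  next
    case False
    txt \<open>As \<open>A\<^sup>2 = l\<^sup>2\<close>, the range of \<open>A + l\<close> consists of eigenvectors for \<open>l\<close>, and \<open>A + l\<close> is
      nonzero because its trace is \<open>2 l\<close>.\<close>
    obtain x where x: "x \<in> {e, f}" "A x + of_real l *\<^sub>C x \<noteq> 0"
    proof (rule ccontr)
      assume "\<not> thesis"
      then have "A e + of_real l *\<^sub>C e = 0" "A f + of_real l *\<^sub>C f = 0"
        using that by auto
      then have "cinner e (A e) + of_real l = 0" "cinner f (A f) + of_real l = 0"
        using cinner_add_right[of e "A e" "of_real l *\<^sub>C e"]
          cinner_add_right[of f "A f" "of_real l *\<^sub>C f"] ef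
        by (auto simp: cinner_scaleC_right)
      then have "a + l = 0" "- a + l = 0"
        unfolding a a' by (auto simp: complex_eq_iff)
      then show False using False by simp
    qed
    define w where "w = A x + of_real l *\<^sub>C x"
    have AAx: "A (A x) = (of_real l * of_real l) *\<^sub>C x" using x(1) AAe AAf by auto
    have Aw: "A w = of_real l *\<^sub>C w"
      by (simp add: w_def clinear_add[OF lin] clinear_scaleC[OF lin] AAx
          complex_vector.scale_right_distrib add.commute)
    obtain k where k: "cinner (k *\<^sub>C w) (k *\<^sub>C w) = 1"
      using normalized_exists x(2) w_def by metis
    define b where "b = k *\<^sub>C w"
    have Ab: "A b = of_real l *\<^sub>C b"
      by (simp add: b_def clinear_scaleC[OF lin] Aw mult.commute)
    have bb: "cinner b b = 1" using k by (simp add: b_def)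
    obtain c where c: "b \<noteq> c" "orthonormal_basis {b, c}" "cinner c c = 1" "cinner b c = 0"
      using extend_unit_vector[OF dim bb] .
    \<comment> \<open>Symmetry keeps the orthogonal complement of the eigenvector \<open>b\<close>
      invariant, and this complement is the line of \<open>c\<close>. The vanishing trace then fixes
      the second eigenvalue.\<close>
    have "cinner b (A c) = 0"
      by (simp add: sym Ab cinner_scaleC_left c)
    then have Ac: "A c = cinner c (A c) *\<^sub>C c"
      using orthonormal_expansion[OF c(2), of "A c"] c(1) by simp
    have "cinner b (A b) + cinner c (A c) = 0"
      using trace_eq_sum[OF lin c(2)] tr c(1) by simp
    then have "cinner c (A c) = of_real (- l)"
      by (simp add: Ab cinner_scaleC_right bb add_eq_0_iff)
    then show thesis
      using that[OF c(1,2) \<open>l \<ge> 0\<close> Ab] Ac by simp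
  qed
qed


subsection \<open>Spectral projectors of a traceless operator\<close>

text \<open>Two candidates for the projection differ by a vector of \<open>S\<close> that is
  orthogonal to itself, hence zero; so the definite description is determined.\<close>

lemma orth_proj_eqI:
  assumes S: "complex_vector.subspace S" and y: "y \<in> S"
    and orth: "\<And>z. z \<in> S \<Longrightarrow> cinner z (x - y) = 0"
  shows "orth_proj S x = y"
  unfolding orth_proj_def
proof (rule the_equality)
  show "y \<in> S \<and> (\<forall>z\<in>S. cinner z (x - y) = 0)" using y orth by blast
next
  fix y' assume y': "y' \<in> S \<and> (\<forall>z\<in>S. cinner z (x - y') = 0)"
  have d: "y - y' \<in> S" using S y y' by (simp add: complex_vector.subspace_diff)
  have "cinner (y - y') ((x - y') - (x - y)) = 0"
    unfolding cinner_diff_right[of "y - y'" "x - y'"] using orth[OF d] y' d by simp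
  then show "y' = y" by (simp add: cinner_eq_zero_iff)
qed

text \<open>The components of \<open>A x\<close> along \<open>b\<close> and \<open>c\<close> are
  computed in two ways. The product form lets \<open>m\<close> coincide with \<open>l\<close>, with
  \<open>- l\<close>, or with both if \<open>l = 0\<close>.\<close>

lemma eigenvalue_plus_minus:
  assumes lin: "clinear A" and bc: "b \<noteq> c" "orthonormal_basis {b, c}"
    and A: "A b = of_real l *\<^sub>C b" "A c = of_real (- l) *\<^sub>C c"
    and x: "A x = of_real m *\<^sub>C x"
  shows "of_real (m - l) * cinner b x = 0" "of_real (m + l) * cinner c x = 0"
proof -
  have on: "cinner b b = 1" "cinner c c = 1" "cinner b c = 0" "cinner c b = 0"
    using bc by (auto simp: orthonormal_basis_def)
  have ex: "x = cinner b x *\<^sub>C b + cinner c x *\<^sub>C c"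
    using orthonormal_expansion[OF bc(2), of x] bc(1) by simp
  have Ax: "A x = (cinner b x * of_real l) *\<^sub>C b + (cinner c x * of_real (- l)) *\<^sub>C c"
    by (subst ex) (simp add: clinear_add[OF lin] clinear_scaleC[OF lin] A)
  have "cinner b (of_real m *\<^sub>C x) = cinner b x * of_real l"
    unfolding x[symmetric] Ax by (simp add: cinner_diff_right cinner_scaleC_right on)
  then show "of_real (m - l) * cinner b x = 0"
    by (simp add: cinner_scaleC_right algebra_simps)
  have "cinner c (of_real m *\<^sub>C x) = cinner c x * of_real (- l)"
    unfolding x[symmetric] Ax by (simp add: cinner_diff_right cinner_scaleC_right on)
  then show "of_real (m + l) * cinner c x = 0"
    by (simp add: cinner_scaleC_right algebra_simps)
qed

text \<open>For \<open>l > 0\<close> the kernel is trivial and the negative eigenvectors span the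
  line of \<open>c\<close>. For \<open>l = 0\<close> the operator is zero, so the kernel is the
  whole space and half the identity remains.\<close>

lemma proj_neg_null_eq:
  fixes A :: "'h::complex_inner \<Rightarrow> 'h"
  assumes lin: "clinear A" and bc: "b \<noteq> c" "orthonormal_basis {b, c}" and l: "l \<ge> 0"
    and A: "A b = of_real l *\<^sub>C b" "A c = of_real (- l) *\<^sub>C c"
  shows "proj_neg A x + (1/2) *\<^sub>C proj_null A x =
    (if l = 0 then (1/2) *\<^sub>C x else cinner c x *\<^sub>C c)"
proof -
  have on: "cinner b b = 1" "cinner c c = 1" "cinner b c = 0" "cinner c b = 0"
    using bc by (auto simp: orthonormal_basis_def)
  have ex: "x = cinner b x *\<^sub>C b + cinner c x *\<^sub>C c" for x
    using orthonormal_expansion[OF bc(2), of x] bc(1) by simp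
  note ev = eigenvalue_plus_minus[OF lin bc A]
  define N where "N = {x. x \<noteq> 0 \<and> (\<exists>l::real. l < 0 \<and> A x = complex_of_real l *\<^sub>C x)}"
  \<comment> \<open>As \<open>m < 0 \<le> l\<close>, the factor \<open>m - l\<close> is nonzero and
    the component along \<open>b\<close> vanishes. The component along \<open>c\<close> is then
    nonzero, which forces \<open>m = - l\<close>.\<close>
  have neg: "m = - l \<and> cinner b x = 0"
    if "m < 0" "A x = of_real m *\<^sub>C x" "x \<noteq> 0" for m x
  proof -
    have 0: "cinner b x = 0"
      using ev(1)[OF that(2)] that(1) l by (auto simp flip: of_real_diff)
    then have "cinner c x \<noteq> 0" using ex[of x] that(3) by auto
    then show ?thesis using 0 ev(2)[OF that(2)] by (auto simp flip: of_real_add)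
  qed
  show ?thesis
  proof (cases "l = 0")
    case True
    have "A x = 0" for x
      by (subst ex) (simp add: clinear_add[OF lin] clinear_scaleC[OF lin] A True)
    then have "{x. A x = 0} = UNIV" "N = {}" using neg True by (auto simp: N_def)
    then have "proj_null A x = x" "proj_neg A x = 0"
      unfolding proj_null_def proj_neg_def N_def[symmetric]
      by (auto intro!: orth_proj_eqI)
    then show ?thesis using True by simp
  next
    case False
    with l have "l > 0" by simp
    have "x = 0" if "A x = 0" for x
    proof -
      have "A x = of_real 0 *\<^sub>C x" using that by simp
      from ev[OF this] False have "cinner b x = 0" "cinner c x = 0" by auto
      then show ?thesis using ex[of x] by simp
    qed
    moreover have "A 0 = 0" using clinear_scaleC[OF lin, of 0 0] by simp
    ultimately have "{x. A x = 0} = {0}" by auto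
    then have null: "proj_null A x = 0"
      unfolding proj_null_def by (auto intro!: orth_proj_eqI)
    have "c \<noteq> 0" using on by auto
    then have "c \<in> N" unfolding N_def using \<open>l > 0\<close> A(2) by (auto intro!: exI[of _ "- l"])
    moreover have "N \<subseteq> cspan {c}"
    proof
      fix y assume "y \<in> N"
      then have "cinner b y = 0" using neg by (auto simp: N_def)
      then have "y = cinner c y *\<^sub>C c" using ex[of y] by simp
      then show "y \<in> cspan {c}" by (auto simp: complex_vector.span_singleton)
    qed
    ultimately have N: "cspan N = cspan {c}"
      by (intro complex_vector.span_eq[THEN iffD2]) (auto intro: complex_vector.span_base)
    have "orth_proj (cspan {c}) x = cinner c x *\<^sub>C c"
      by (rule orth_proj_eqI[OF complex_vector.subspace_span])
        (auto simp: complex_vector.span_singleton cinner_scaleC_left cinner_scaleC_right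
          cinner_diff_right on)
    then have "proj_neg A x = cinner c x *\<^sub>C c"
      by (simp add: proj_neg_def N_def[symmetric] N)
    then show ?thesis using null False by simp
  qed
qed


subsection \<open>Traces\<close>

text \<open>Real coefficients equal their conjugates and so pass through both arguments of the inner
  product. \<open>guess_op\<close> is such a combination.\<close>

lemma hermitian_real_combination:
  fixes A :: "'i \<Rightarrow> 'h::complex_inner \<Rightarrow> 'h"
  assumes "\<And>i. i \<in> I \<Longrightarrow> hermitian (A i)"
  shows "hermitian (\<lambda>x. \<Sum>i\<in>I. of_real (r i) *\<^sub>C A i x)"
  unfolding hermitian_def
proof (intro conjI allI)
  have lin: "\<And>i. i \<in> I \<Longrightarrow> clinear (A i)" using assms by (auto simp: hermitian_def)
  show "clinear (\<lambda>x. \<Sum>i\<in>I. of_real (r i) *\<^sub>C A i x)"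
  proof (rule clinearI)
    fix x y
    show "(\<Sum>i\<in>I. of_real (r i) *\<^sub>C A i (x + y)) =
        (\<Sum>i\<in>I. of_real (r i) *\<^sub>C A i x) + (\<Sum>i\<in>I. of_real (r i) *\<^sub>C A i y)"
      by (simp add: sum.distrib[symmetric] clinear_add[OF lin]
          complex_vector.scale_right_distrib cong: sum.cong)
  next
    fix k x
    show "(\<Sum>i\<in>I. of_real (r i) *\<^sub>C A i (k *\<^sub>C x)) = k *\<^sub>C (\<Sum>i\<in>I. of_real (r i) *\<^sub>C A i x)"
      by (simp add: complex_vector.scale_sum_right clinear_scaleC[OF lin] mult.commute
          cong: sum.cong)
  qed
  fix x y
  show "cinner x (\<Sum>i\<in>I. of_real (r i) *\<^sub>C A i y) = cinner (\<Sum>i\<in>I. of_real (r i) *\<^sub>C A i x) y"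
    using assms
    by (auto simp: cinner_sum_right cinner_sum_left cinner_scaleC_right cinner_scaleC_left
        hermitian_def intro!: sum.cong)
qed

text \<open>\<open>trace\<close> is a sum over one fixed set, so interchanging two sums
  suffices.\<close>

lemma trace_linear_combination:
  fixes A :: "'i \<Rightarrow> 'h::complex_inner \<Rightarrow> 'h"
  shows "trace (\<lambda>x. \<Sum>i\<in>I. k i *\<^sub>C A i x) = (\<Sum>i\<in>I. k i * trace (A i))"
  unfolding trace_def cinner_sum_right cinner_scaleC_right sum_distrib_left
  by (rule sum.swap)

text \<open>Moving \<open>A\<close> to the left argument of \<open>cinner b (A (P b))\<close> turns
  it into its real eigenvalue, so only the diagonal entries of \<open>P\<close> enter.\<close>

lemma trace_comp_hermitian_eigenbasis:
  assumes A: "hermitian A" and P: "clinear P" and bc: "b \<noteq> c" "orthonormal_basis {b, c}"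
    and ev: "A b = of_real l *\<^sub>C b" "A c = of_real m *\<^sub>C c"
  shows "trace (A \<circ> P) = of_real l * cinner b (P b) + of_real m * cinner c (P c)"
proof -
  have lin: "clinear A" and sym: "\<And>x y. cinner x (A y) = cinner (A x) y"
    using A by (auto simp: hermitian_def)
  have "clinear (A \<circ> P)"
    using lin P by (intro clinearI) (simp_all add: clinear_add clinear_scaleC)
  from trace_eq_sum[OF this bc(2)] show ?thesis
    using bc(1) by (simp add: sym ev cinner_scaleC_left)
qed

text \<open>With \<open>p\<close>, \<open>q\<close> the nonnegative diagonal entries of
  \<open>P\<close>, the claim is \<open>l * p - l * q \<ge> - L * (p + q)\<close>, that is,
  \<open>(l + L) * p + (L - l) * q \<ge> 0\<close>. A common bound \<open>L\<close> is used because
  only the sum of the traces of a measurement is known.\<close>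

lemma trace_comp_ge:
  assumes A: "hermitian A" and P: "pos_semidef P" and bc: "b \<noteq> c" "orthonormal_basis {b, c}"
    and l: "l \<le> L" "l \<ge> 0"
    and ev: "A b = of_real l *\<^sub>C b" "A c = of_real (- l) *\<^sub>C c"
  shows "Re (trace (A \<circ> P)) \<ge> - L * Re (trace P)"
proof -
  have lin: "clinear P" and pos: "0 \<le> Re (cinner b (P b))" "0 \<le> Re (cinner c (P c))"
    using P by (auto simp: pos_semidef_def hermitian_def)
  have 1: "Re (trace (A \<circ> P)) = l * Re (cinner b (P b)) - l * Re (cinner c (P c))"
    using trace_comp_hermitian_eigenbasis[OF A lin bc ev] by simp
  have 2: "Re (trace P) = Re (cinner b (P b)) + Re (cinner c (P c))"
    using trace_eq_sum[OF lin bc(2)] bc(1) by simp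
  have "0 \<le> (l + L) * Re (cinner b (P b))" "0 \<le> (L - l) * Re (cinner c (P c))"
    using l pos by simp_all
  then show ?thesis unfolding 1 2 by (simp add: algebra_simps)
qed

text \<open>This is the total trace of the values of any measurement.\<close>

lemma trace_id:
  assumes "cdim (UNIV :: 'h::complex_inner set) = 2"
  shows "trace (\<lambda>x::'h. x) = 2"
proof -
  obtain e f :: 'h where "e \<noteq> f" "orthonormal_basis {e, f}"
    "cinner e e = 1" "cinner f f = 1" "cinner e f = 0"
    using orthonormal_pair_exists[OF assms] .
  then show ?thesis
    using trace_eq_sum[of "\<lambda>x::'h. x" "{e, f}"] clinearI[of "\<lambda>x::'h. x"] by simp
qed

lemma sum_guess_coefficients: "(\<Sum>t=1..N. 2 * real t - real N - 1) = 0"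
proof -
  \<comment> \<open>\<open>N\<close> also occurs in the summand, so the induction runs over a
    separate upper limit \<open>k\<close>; the closed form vanishes at \<open>k = N\<close>.\<close>
  have "(\<Sum>t=1..k. 2 * real t - real N - 1) = real k * (real k - real N)" for k
    by (induction k) (auto simp: algebra_simps)
  from this[of N] show ?thesis by simp
qed


subsection \<open>Numberings\<close>

text \<open>Being extensional, numberings lie in a finite set of functions.\<close>

lemma finite_numberings: "finite M \<Longrightarrow> finite (numberings M)"
  by (rule finite_subset[of _ "{1..card M} \<rightarrow>\<^sub>E M", OF _ finite_PiE])
    (auto simp: numberings_def bij_betw_def PiE_def)

lemma restrict_in_numberings:
  "bij_betw h {1..card M} M \<Longrightarrow> restrict h {1..card M} \<in> numberings M"
  by (simp add: numberings_def)

lemma numberings_nonempty: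
  assumes "finite M"
  shows "numberings M \<noteq> {}"
proof -
  obtain h where "bij_betw h {1..card M} M"
    using ex_bij_betw_nat_finite_1[OF assms] by blast
  then show ?thesis using restrict_in_numberings by blast
qed

lemma numberings_bij: "n \<in> numberings M \<Longrightarrow> bij_betw n {1..card M} M"
  by (simp add: numberings_def)

lemma bij_betw_reflect: "bij_betw (\<lambda>t. N + 1 - t) {1..N} {1..N::nat}"
  by (rule bij_betw_byWitness[where f' = "\<lambda>t. N + 1 - t"]) auto

lemma reversed_in_numberings:
  assumes "n \<in> numberings M"
  shows "reversed M n \<in> numberings M"
proof -
  have "bij_betw (n \<circ> (\<lambda>t. card M + 1 - t)) {1..card M} M"
    using bij_betw_trans[OF bij_betw_reflect numberings_bij[OF assms]] .
  then show ?thesis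
    unfolding reversed_def o_def by (rule restrict_in_numberings)
qed

text \<open>Otherwise the numbering takes the same value at the two distinct positions
  \<open>1\<close> and \<open>card M\<close>, against injectivity.\<close>

lemma reversed_neq:
  assumes "n \<in> numberings M" "card M \<ge> 2"
  shows "reversed M n \<noteq> n"
proof
  assume "reversed M n = n"
  then have "n (card M) = n 1" using assms(2) by (auto simp: reversed_def dest: fun_cong[of _ _ 1])
  then show False
    using numberings_bij[OF assms(1)] assms(2) by (auto simp: bij_betw_def dest!: inj_onD)
qed

section \<open>The operators E(n)\<close>

text \<open>The substitution of \<open>card M + 1 - t\<close> for \<open>t\<close> changes the sign
  of the coefficient \<open>2 * t - card M - 1\<close>.\<close>

lemma guess_op_reversed: "guess_op M \<rho> (reversed M n) x = - guess_op M \<rho> n x"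
proof -
  have "guess_op M \<rho> (reversed M n) x =
      (\<Sum>t=1..card M. complex_of_real (2 * real t - real (card M) - 1) *\<^sub>C
        \<rho> (n (card M + 1 - t)) x)"
    unfolding guess_op_def by (intro sum.cong) (auto simp: reversed_def)
  also have "\<dots> = (\<Sum>t=1..card M. - (complex_of_real (2 * real t - real (card M) - 1) *\<^sub>C \<rho> (n t) x))"
    by (rule sum.reindex_bij_witness[where i = "\<lambda>t. card M + 1 - t" and j = "\<lambda>t. card M + 1 - t"])
      (auto simp: of_nat_diff complex_vector.scale_minus_left[symmetric] algebra_simps
        simp del: complex_vector.scale_minus_left)
  finally show ?thesis by (simp add: guess_op_def sum_negf)
qed

lemma guess_op_hermitian:
  assumes "\<rho> \<in> ensembles M" "n \<in> numberings M"
  shows "hermitian (guess_op M \<rho> n)"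
  unfolding guess_op_def
  using assms(1) bij_betw_apply[OF numberings_bij[OF assms(2)]]
  by (intro hermitian_real_combination) (auto simp: ensembles_def pos_semidef_def)

text \<open>This is where the uniform prior enters: the common trace factors out and the
  coefficients sum to zero.\<close>

lemma trace_guess_op:
  assumes "n \<in> numberings M" "\<forall>m\<in>M. trace (\<rho> m) = 1 / of_nat (card M)"
  shows "trace (guess_op M \<rho> n) = 0"
proof -
  have "trace (guess_op M \<rho> n) =
      (\<Sum>t=1..card M. complex_of_real (2 * real t - real (card M) - 1) * (1 / of_nat (card M)))"
    unfolding guess_op_def trace_linear_combination
    using assms(2) bij_betw_apply[OF numberings_bij[OF assms(1)]] by (intro sum.cong) auto
  also have "\<dots> = complex_of_real (\<Sum>t=1..card M. 2 * real t - real (card M) - 1) / of_nat (card M)"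
    by (simp add: sum_divide_distrib)
  finally show ?thesis unfolding sum_guess_coefficients by simp
qed

section \<open>The guesswork as a sum of traces\<close>

lemma guesswork_eq:
  fixes \<rho> :: "'m \<Rightarrow> 'h::complex_inner \<Rightarrow> 'h"
  assumes \<rho>: "\<rho> \<in> ensembles M" and \<pi>: "\<pi> \<in> measurements M"
  shows "guesswork M \<rho> \<pi> =
    (real (card M) + 1) / 2 + (\<Sum>n\<in>numberings M. Re (trace (guess_op M \<rho> n \<circ> \<pi> n))) / 2"
proof -
  define q where "q n t = Re (trace (\<rho> (n t) \<circ> \<pi> n))" for n t
  have E: "Re (trace (guess_op M \<rho> n \<circ> \<pi> n)) = (\<Sum>t=1..card M. (2 * real t - real (card M) - 1) * q n t)"
    for n
  proof -
    have "guess_op M \<rho> n \<circ> \<pi> n = (\<lambda>x. \<Sum>t=1..card M.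
        complex_of_real (2 * real t - real (card M) - 1) *\<^sub>C (\<rho> (n t) \<circ> \<pi> n) x)"
      by (simp add: guess_op_def fun_eq_iff)
    then show ?thesis by (simp add: trace_linear_combination q_def comp_def del: of_real_diff)
  qed
  \<comment> \<open>For each \<open>n\<close> the positions are reindexed by the elements of
    \<open>M\<close>; summing over \<open>n\<close> first, the measurement adds up to the identity
    and leaves the total trace of the ensemble.\<close>
  have tot: "(\<Sum>n\<in>numberings M. \<Sum>t=1..card M. q n t) = 1"
  proof -
    have "(\<Sum>n\<in>numberings M. \<Sum>t=1..card M. q n t) =
        (\<Sum>n\<in>numberings M. \<Sum>m\<in>M. Re (trace (\<rho> m \<circ> \<pi> n)))"
      unfolding q_def using numberings_bij by (intro sum.cong sum.reindex_bij_betw refl) blast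
    also have "\<dots> = (\<Sum>m\<in>M. Re (\<Sum>n\<in>numberings M. 1 * trace (\<rho> m \<circ> \<pi> n)))"
      by (subst sum.swap) simp
    also have "\<dots> = (\<Sum>m\<in>M. Re (trace (\<rho> m)))"
    proof (rule sum.cong)
      fix m assume "m \<in> M"
      then have "clinear (\<rho> m)" using \<rho> by (auto simp: ensembles_def pos_semidef_def hermitian_def)
      then have "(\<Sum>n\<in>numberings M. \<rho> m (\<pi> n x)) = \<rho> m (\<Sum>n\<in>numberings M. \<pi> n x)" for x
        by (rule clinear_sum[symmetric])
      \<comment> \<open>The factor \<open>1\<close> gives the sum the shape of a linear combination,
        as \<open>trace_linear_combination\<close> requires.\<close>
      then have "(\<lambda>x. \<Sum>n\<in>numberings M. 1 *\<^sub>C (\<rho> m \<circ> \<pi> n) x) = \<rho> m"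
        using \<pi> by (simp add: measurements_def)
      then show "Re (\<Sum>n\<in>numberings M. 1 * trace (\<rho> m \<circ> \<pi> n)) = Re (trace (\<rho> m))"
        using trace_linear_combination[of "\<lambda>_. 1" "\<lambda>n. \<rho> m \<circ> \<pi> n" "numberings M"] by simp
    qed simp
    also have "\<dots> = 1"
      using \<rho> by (simp add: ensembles_def flip: Re_sum)
    finally show ?thesis .
  qed
  have "guesswork M \<rho> \<pi> = (\<Sum>t=1..card M. \<Sum>n\<in>numberings M. real t * q n t)"
    by (simp add: guesswork_def guess_prob_def q_def sum_distrib_left)
  also have "\<dots> = (\<Sum>n\<in>numberings M. \<Sum>t=1..card M. real t * q n t)"
    by (rule sum.swap)
  also have "\<dots> = (\<Sum>n\<in>numberings M. \<Sum>t=1..card M.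
      (real (card M) + 1) / 2 * q n t + (2 * real t - real (card M) - 1) * q n t / 2)"
    by (intro sum.cong refl) (simp add: field_simps)
  also have "\<dots> = (real (card M) + 1) / 2 * (\<Sum>n\<in>numberings M. \<Sum>t=1..card M. q n t) +
      (\<Sum>n\<in>numberings M. Re (trace (guess_op M \<rho> n \<circ> \<pi> n))) / 2"
    unfolding E by (simp only: sum.distrib sum_distrib_left sum_divide_distrib)
  finally show ?thesis unfolding tot by simp
qed

section \<open>The measurement of a numbering and its reversal\<close>

text \<open>The quadratic form at \<open>x\<close> is the squared modulus of
  \<open>cinner c x\<close>. For a unit vector \<open>c\<close> this is the projector that the
  measurement uses when \<open>l > 0\<close>.\<close>

lemma pos_semidef_rank_one: "pos_semidef (\<lambda>x. cinner c x *\<^sub>C (c :: 'h::complex_inner))"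
proof -
  have "cinner x (cinner c y *\<^sub>C c) = cinner (cinner c x *\<^sub>C c) y" for x y
    by (simp add: cinner_scaleC_left cinner_scaleC_right cinner_commute[symmetric] mult.commute)
  moreover have "0 \<le> Re (cinner x (cinner c x *\<^sub>C c))" for x
  proof -
    have "cinner x (cinner c x *\<^sub>C c) = cinner c x * cnj (cinner c x)"
      by (simp add: cinner_scaleC_right cinner_commute[symmetric])
    then show ?thesis by (simp flip: complex_norm_square of_real_power)
  qed
  ultimately show ?thesis
    by (auto simp: pos_semidef_def hermitian_def cinner_add_right cinner_scaleC_right
        complex_vector.scale_left_distrib intro!: clinearI)
qed

text \<open>Both nonzero values of the measurement have this form when \<open>l = 0\<close>.\<close>

lemma pos_semidef_half: "pos_semidef (\<lambda>x::'h::complex_inner. (1/2) *\<^sub>C x)"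
  using cinner_ge_zero
  by (auto simp: pos_semidef_def hermitian_def cinner_scaleC_left cinner_scaleC_right
      complex_vector.scale_right_distrib mult.commute intro!: clinearI)

lemma pos_semidef_zero: "pos_semidef (\<lambda>x::'h::complex_inner. 0)"
  by (auto simp: pos_semidef_def hermitian_def intro!: clinearI)

text \<open>The reversed numbering has the same eigenbasis with \<open>b\<close> and
  \<open>c\<close> exchanged. The two values are thus the projectors on the lines of
  \<open>c\<close> and \<open>b\<close>, or twice half the identity if \<open>l = 0\<close>. They
  add up to the identity, and each contributes \<open>- l\<close> to the sum of traces.\<close>

lemma guess_meas_optimal:
  fixes \<rho> :: "'m \<Rightarrow> 'h::complex_inner \<Rightarrow> 'h"
  assumes M: "finite M" "card M \<ge> 2" and \<rho>: "\<rho> \<in> ensembles M" and ns: "ns \<in> numberings M"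
    and bc: "b \<noteq> c" "orthonormal_basis {b, c}" and l: "l \<ge> 0"
    and ev: "guess_op M \<rho> ns b = of_real l *\<^sub>C b" "guess_op M \<rho> ns c = of_real (- l) *\<^sub>C c"
  shows "guess_meas M \<rho> ns \<in> measurements M"
    and "guesswork M \<rho> (guess_meas M \<rho> ns) = (real (card M) + 1) / 2 - l"
proof -
  define A where "A = guess_op M \<rho> ns"
  define A' where "A' = guess_op M \<rho> (reversed M ns)"
  define P where "P = guess_meas M \<rho> ns ns"
  define P' where "P' = guess_meas M \<rho> ns (reversed M ns)"
  have ns': "reversed M ns \<in> numberings M" "reversed M ns \<noteq> ns"
    using reversed_in_numberings[OF ns] reversed_neq[OF ns M(2)] by auto
  have h: "hermitian A" "hermitian A'"
    unfolding A_def A'_def using guess_op_hermitian[OF \<rho>] ns ns' by auto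
  then have lin: "clinear A" "clinear A'" by (auto simp: hermitian_def)
  have cb: "c \<noteq> b" "orthonormal_basis {c, b}" using bc by (auto simp: insert_commute)
  have ev': "A' c = of_real l *\<^sub>C c" "A' b = of_real (- l) *\<^sub>C b"
    unfolding A'_def guess_op_reversed ev by simp_all
  have on: "cinner b b = 1" "cinner c c = 1" "cinner b c = 0" "cinner c b = 0"
    using bc by (auto simp: orthonormal_basis_def)
  have P: "P = (\<lambda>x. if l = 0 then (1/2) *\<^sub>C x else cinner c x *\<^sub>C c)"
    using proj_neg_null_eq[OF lin(1) bc l] ev
    by (simp add: P_def guess_meas_def A_def fun_eq_iff)
  have P': "P' = (\<lambda>x. if l = 0 then (1/2) *\<^sub>C x else cinner b x *\<^sub>C b)"
    using proj_neg_null_eq[OF lin(2) cb l ev']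
    by (simp add: P'_def guess_meas_def A'_def fun_eq_iff)
  have other: "guess_meas M \<rho> ns n = (\<lambda>x. 0)" if "n \<notin> {ns, reversed M ns}" for n
    using that by (auto simp: guess_meas_def)
  have psd: "pos_semidef P" "pos_semidef P'"
    by (cases "l = 0"; simp add: P P' pos_semidef_half pos_semidef_rank_one)+
  have plin: "clinear P" "clinear P'"
    using psd by (auto simp: pos_semidef_def hermitian_def)
  have sum2: "(\<Sum>n\<in>numberings M. g n) = g ns + g (reversed M ns)"
    if "\<And>n. n \<notin> {ns, reversed M ns} \<Longrightarrow> g n = 0" for g :: "(nat \<Rightarrow> 'm) \<Rightarrow> 'z::comm_monoid_add"
  proof -
    have "(\<Sum>n\<in>numberings M. g n) = (\<Sum>n\<in>{ns, reversed M ns}. g n)"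
      using finite_numberings[OF M(1)] ns ns' that by (intro sum.mono_neutral_right) auto
    then show ?thesis using ns'(2) by simp
  qed
  have "P x + P' x = x" for x
  proof (cases "l = 0")
    case True
    then show ?thesis
      by (simp add: P P' complex_vector.scale_left_distrib[symmetric])
  next
    case False
    then show ?thesis
      using orthonormal_expansion[OF bc(2), of x] bc(1) by (simp add: P P' add.commute)
  qed
  then have "(\<Sum>n\<in>numberings M. guess_meas M \<rho> ns n x) = x" for x
    using other by (subst sum2) (simp_all add: P_def P'_def)
  moreover have "pos_semidef (guess_meas M \<rho> ns n)" for n
    using psd other[of n] pos_semidef_zero by (cases "n \<in> {ns, reversed M ns}") (auto simp: P_def P'_def)
  ultimately show meas: "guess_meas M \<rho> ns \<in> measurements M"
    by (simp add: measurements_def)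
  have "trace (\<lambda>x::'h. 0) = 0" by (simp add: trace_def)
  \<comment> \<open>Composing with the zero map gives the constant
    \<open>guess_op M \<rho> n 0\<close>, which vanishes by linearity. Linearity is available for
    numberings, so the sum below is restricted directly rather than by \<open>sum2\<close>, which
    asks for vanishing at every \<open>n\<close> outside the pair.\<close>
  moreover have "guess_op M \<rho> n 0 = 0" if "n \<in> numberings M" for n
    using guess_op_hermitian[OF \<rho> that] clinear_scaleC[of "guess_op M \<rho> n" 0 0]
    by (simp add: hermitian_def)
  ultimately have zero: "Re (trace (guess_op M \<rho> n \<circ> guess_meas M \<rho> ns n)) = 0"
    if "n \<notin> {ns, reversed M ns}" "n \<in> numberings M" for n
    using other[OF that(1)] that(2) by (simp add: o_def)
  have "(\<Sum>n\<in>numberings M. Re (trace (guess_op M \<rho> n \<circ> guess_meas M \<rho> ns n))) =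
      (\<Sum>n\<in>{ns, reversed M ns}. Re (trace (guess_op M \<rho> n \<circ> guess_meas M \<rho> ns n)))"
    using finite_numberings[OF M(1)] ns ns' zero by (intro sum.mono_neutral_right) auto
  also have "\<dots> = Re (trace (A \<circ> P)) + Re (trace (A' \<circ> P'))"
    using ns'(2) by (simp add: A_def P_def A'_def P'_def)
  also have "\<dots> = - 2 * l"
    using trace_comp_hermitian_eigenbasis[OF h(1) plin(1) bc ev[folded A_def]]
      trace_comp_hermitian_eigenbasis[OF h(2) plin(2) cb ev']
    by (simp add: P P' on cinner_scaleC_right)
  finally show "guesswork M \<rho> (guess_meas M \<rho> ns) = (real (card M) + 1) / 2 - l"
    unfolding guesswork_eq[OF \<rho> meas] by simp
qed

text \<open>A single element is excluded because \<open>ns\<close> and \<open>reversed M ns\<close>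
  then coincide and the operators sum to half the identity. Membership in
  \<open>measurements M\<close> is asserted separately, since the equality of values does not
  express it.\<close>

theorem corollary1:
  fixes M :: "'m set"
    and \<rho> :: "'m \<Rightarrow> 'h::complex_inner \<Rightarrow> 'h"
  assumes "finite M"
    and "card M \<noteq> 1"
    and "cdim (UNIV :: 'h set) = 2"
    and "\<rho> \<in> ensembles M"
    and "\<forall>m\<in>M. trace (\<rho> m) = 1 / of_nat (card M)"
  shows "\<exists>ns\<in>numberings M.
    guess_meas M \<rho> ns \<in> measurements M \<and>
    min_guesswork M \<rho> = guesswork M \<rho> (guess_meas M \<rho> ns)"
proof -
  \<comment> \<open>An empty sum of traces would be zero instead of one.\<close>
  have "M \<noteq> {}" using assms(4) by (auto simp: ensembles_def)
  then have "card M \<noteq> 0" using assms(1) by simp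
  with assms(2) have card: "card M \<ge> 2" by linarith
  define eig where "eig n b c l \<longleftrightarrow> b \<noteq> c \<and> orthonormal_basis {b, c} \<and> l \<ge> 0 \<and>
    guess_op M \<rho> n b = of_real l *\<^sub>C b \<and> guess_op M \<rho> n c = of_real (- l) *\<^sub>C c" for n b c and l :: real
  have "\<exists>l b c. eig n b c l" if "n \<in> numberings M" for n
    using traceless_hermitian_eigenbasis[OF assms(3) guess_op_hermitian[OF assms(4) that]
        trace_guess_op[OF that assms(5)]]
    unfolding eig_def by metis
  then obtain l b c where eig: "\<And>n. n \<in> numberings M \<Longrightarrow> eig n (b n) (c n) (l n)"
    by metis
  have fin: "finite (l ` numberings M)" "l ` numberings M \<noteq> {}"
    using finite_numberings numberings_nonempty assms(1) by auto
  \<comment> \<open>The witness maximizes the positive eigenvalue, so \<open>l ns\<close> bounds all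
    \<open>l n\<close> and can serve as the common \<open>L\<close> of
    \<open>trace_comp_ge\<close>.\<close>
  obtain ns where ns: "ns \<in> numberings M" and "l ns = Max (l ` numberings M)"
    using Max_in[OF fin] by auto
  then have max: "l n \<le> l ns" if "n \<in> numberings M" for n
    using Max_ge[OF fin(1)] that by simp
  have opt: "guess_meas M \<rho> ns \<in> measurements M"
    "guesswork M \<rho> (guess_meas M \<rho> ns) = (real (card M) + 1) / 2 - l ns"
    using guess_meas_optimal[OF assms(1) card assms(4) ns] eig[OF ns] unfolding eig_def by blast+
  have bound: "(real (card M) + 1) / 2 - l ns \<le> guesswork M \<rho> \<pi>" if \<pi>: "\<pi> \<in> measurements M" for \<pi>
  proof -
    have "(\<lambda>x. \<Sum>n\<in>numberings M. 1 *\<^sub>C \<pi> n x) = (\<lambda>x. x)"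
      using \<pi> by (simp add: measurements_def)
    then have "(\<Sum>n\<in>numberings M. 1 * trace (\<pi> n)) = 2"
      using trace_linear_combination[of "\<lambda>_. 1" \<pi> "numberings M"] trace_id[OF assms(3)] by simp
    then have "(\<Sum>n\<in>numberings M. Re (trace (\<pi> n))) = 2"
      by (simp flip: Re_sum)
    then have "- 2 * l ns = (\<Sum>n\<in>numberings M. - l ns * Re (trace (\<pi> n)))"
      unfolding sum_distrib_left[symmetric] by simp
    also have "\<dots> \<le> (\<Sum>n\<in>numberings M. Re (trace (guess_op M \<rho> n \<circ> \<pi> n)))"
    proof (rule sum_mono)
      fix n assume n: "n \<in> numberings M"
      have "pos_semidef (\<pi> n)" using \<pi> n by (simp add: measurements_def)
      then show "- l ns * Re (trace (\<pi> n)) \<le> Re (trace (guess_op M \<rho> n \<circ> \<pi> n))"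
        using trace_comp_ge[OF guess_op_hermitian[OF assms(4) n]] eig[OF n] max[OF n]
        unfolding eig_def by blast
    qed
    finally show ?thesis unfolding guesswork_eq[OF assms(4) \<pi>] by simp
  qed
  have "min_guesswork M \<rho> = guesswork M \<rho> (guess_meas M \<rho> ns)"
    unfolding min_guesswork_def
    \<comment> \<open>The least element is identified by exhibiting it: the value is attained by
      \<open>opt\<close> and is a lower bound by \<open>bound\<close>.\<close>
    by (rule Least_equality) (use opt(1) bound in \<open>auto simp: opt(2)[symmetric]\<close>)
  with ns opt show ?thesis by blast
qed

end
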